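(* Let $G$ be a countably infinite group, $\sigma\in Z^2(G,\mathbb{T})$ and $d\in ND_0^+(G)$. Assume that $d$ is proper and that $G$ has subexponential H-growth with respect to $d$. Then $\epsilon(d,\sigma)=0$, i.e., $(G,\sigma)$ has the heat property with respect to $d$.
   Context: $Z^2(G,\mathbb{T})$ is the group of normalized 2-cocycles $\sigma:G\times G\to\mathbb{T}$ (i.e. $\sigma(g,h)\sigma(gh,k)=\sigma(h,k)\sigma(g,hk)$, $\sigma(g,e)=\sigma(e,g)=1$). $\Lambda_\sigma$ is the left regular $\sigma$-projective representation on $\ell^2(G)$: $\Lambda_\sigma(g)\delta_h=\sigma(g,h)\delta_{gh}$; when $\sigma=1$ write $\lambda$. $C_r^*(G,\sigma)$ is the operator-norm closure in $\mathcal{B}(\ell^2(G))$ of $\mathrm{Span}(\Lambda_\sigma(G))$. For $x\in C_r^*(G,\sigma)$, $\widehat{x}:=x\delta_e\in\ell^2(G)$, and the Fourier series of $x$ is $\sum_{g\in G}\widehat{x}(g)\Lambda_\sigma(g)$. Convergence of a series $\sum_{g\in G}x_g$ means unordered convergence in operator norm: convergence of the net of finite partial sums indexed by the finite subsets of $G$ directed by inclusion. $CF(G,\sigma)$ is the set of $x\in C_r^*(G,\sigma)$ whose Fourier series is convergent. $MA(G,\sigma)$ is the set of bounded functions $\varphi:G\to\mathbb{C}$ for which there is a (unique) bounded linear operator $M_\varphi$ on $C_r^*(G,\sigma)$ with $M_\varphi(\Lambda_\sigma(g))=\varphi(g)\Lambda_\sigma(g)$ for all $g$. $MCF(G,\sigma)$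 is the set of $\varphi\in MA(G,\sigma)$ such that $M_\varphi$ maps $C_r^*(G,\sigma)$ into $CF(G,\sigma)$. $ND_0^+(G)$ is the set of functions $d:G\to[0,\infty)$ with $d(e)=0$ that are negative definite: $d(g^{-1})=d(g)$ for all $g$, and $\sum_{i,j=1}^n\overline{b_i}b_j\,d(g_i^{-1}g_j)\le 0$ for all $n$, $g_1,\dots,g_n\in G$ and $b_1,\dots,b_n\in\mathbb{C}$ with $\sum_i b_i=0$. For $d\in ND_0^+(G)$ and $t\ge 0$ one has $e^{-td}\in MA(G,\sigma)$; put $M_t^d:=M_{e^{-td}}$. Set $\epsilon(d,\sigma):=\inf\{t>0: e^{-td}\in MCF(G,\sigma)\}\in[0,\infty]$ (with $\inf\emptyset=\infty$). $(G,\sigma)$ has the heat property with respect to $d$ if $e^{-td}\in MCF(G,\sigma)$ for all $t>0$ (equivalently $M_t^d(x)\in CF(G,\sigma)$ for every $x\in C_r^*(G,\sigma)$ and $t>0$). A function $L:G\to[0,\infty)$ is proper if $\{g\in G:L(g)\le r\}$ is finite for every $r\ge0$. For a nonempty finite set $E\subseteq G$ the Haagerup content is $c(E):=\sup\{\|x\|: x\in\mathbb{C}(G),\ \mathrm{supp}(\widehat{x})\subseteq E,\ \|\widehat{x}\|_2\le1\}$, where $\mathbb{C}(G)=\mathrm{Span}(\lambda(G))\subseteq\mathcal{B}(\ell^2(G))$ with operator norm. For a proper $L:G\to[0,\infty)$ with $L(e)=0$, $G$ has subexponential H-growth with respect to $L$ if for any $b>1$ there exists $r_1\ge0$ such that $c(\{g\in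 G:L(g)\le r\})<b^r$ for all $r\ge r_1$. *)

theory Defs
  imports "HOL-Analysis.Analysis" "HOL-Library.Nonpos_Ints"
begin

text \<open>
  The group \<open>G\<close> is the universe of a type of class \<^class>\<open>group_add\<close>. That class is not assumed
  commutative, so it is an arbitrary group, written additively: \<open>g + h\<close> is the product \<open>gh\<close>,
  \<open>- g\<close> is the inverse of \<open>g\<close> and \<open>0\<close> is the neutral element \<open>e\<close>.
\<close>

section \<open>The Hilbert space of square-summable functions\<close>

typedef 'a ell2 = "{f :: 'a \<Rightarrow> complex. (\<lambda>x. (cmod (f x))\<^sup>2) summable_on UNIV}"
  morphisms ell2_fun Abs_ell2
  by (rule exI[of _ "\<lambda>_. 0"]) simp

setup_lifting type_definition_ell2

lemma ell2_summable: "(\<lambda>x. (cmod (ell2_fun f x))\<^sup>2) summable_on UNIV"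
  using ell2_fun[of f] by simp

lemma square_summableI:
  fixes f :: "'a \<Rightarrow> complex"
  assumes "\<And>F. finite F \<Longrightarrow> L2_set (\<lambda>x. cmod (f x)) F \<le> C"
  shows "(\<lambda>x. (cmod (f x))\<^sup>2) summable_on UNIV"
    and "sqrt (\<Sum>\<^sub>\<infinity>x. (cmod (f x))\<^sup>2) \<le> C"
proof -
  have C: "0 \<le> C"
    using assms[of "{}"] by simp
  have le: "(\<Sum>x\<in>F. (cmod (f x))\<^sup>2) \<le> C\<^sup>2" if "finite F" for F
    using assms[OF that] C by (simp add: L2_set_def sqrt_le_D)
  show summ: "(\<lambda>x. (cmod (f x))\<^sup>2) summable_on UNIV"
    by (rule nonneg_bdd_above_summable_on) (auto intro!: bdd_aboveI[of _ "C\<^sup>2"] le)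
  have "(\<Sum>\<^sub>\<infinity>x. (cmod (f x))\<^sup>2) \<le> C\<^sup>2"
    by (rule infsum_le_finite_sums[OF summ]) (auto intro: le)
  then show "sqrt (\<Sum>\<^sub>\<infinity>x. (cmod (f x))\<^sup>2) \<le> C"
    using C by (simp add: real_le_lsqrt)
qed

lemma L2_set_le_infsum:
  fixes f :: "'a \<Rightarrow> complex"
  assumes "(\<lambda>x. (cmod (f x))\<^sup>2) summable_on UNIV" "finite F"
  shows "L2_set (\<lambda>x. cmod (f x)) F \<le> sqrt (\<Sum>\<^sub>\<infinity>x. (cmod (f x))\<^sup>2)"
  unfolding L2_set_def real_sqrt_le_iff
  by (rule finite_sum_le_infsum) (use assms in auto)

lemma L2_set_add_le:
  fixes f g :: "'a \<Rightarrow> complex"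
  assumes "(\<lambda>x. (cmod (f x))\<^sup>2) summable_on UNIV" "(\<lambda>x. (cmod (g x))\<^sup>2) summable_on UNIV"
    and "finite F"
  shows "L2_set (\<lambda>x. cmod (f x + g x)) F
           \<le> sqrt (\<Sum>\<^sub>\<infinity>x. (cmod (f x))\<^sup>2) + sqrt (\<Sum>\<^sub>\<infinity>x. (cmod (g x))\<^sup>2)"
proof -
  have "L2_set (\<lambda>x. cmod (f x + g x)) F \<le> L2_set (\<lambda>x. cmod (f x) + cmod (g x)) F"
    by (rule L2_set_mono) (auto intro: norm_triangle_ineq)
  also have "\<dots> \<le> L2_set (\<lambda>x. cmod (f x)) F + L2_set (\<lambda>x. cmod (g x)) F"
    by (rule L2_set_triangle_ineq)
  also have "\<dots> \<le> sqrt (\<Sum>\<^sub>\<infinity>x. (cmod (f x))\<^sup>2) + sqrt (\<Sum>\<^sub>\<infinity>x. (cmod (g x))\<^sup>2)"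
    by (intro add_mono L2_set_le_infsum assms)
  finally show ?thesis .
qed

lemma square_summable_scale:
  fixes f :: "'a \<Rightarrow> complex"
  assumes "(\<lambda>x. (cmod (f x))\<^sup>2) summable_on UNIV"
  shows "(\<lambda>x. (cmod (c * f x))\<^sup>2) summable_on UNIV"
  using summable_on_cmult_right[OF assms, of "(cmod c)\<^sup>2"]
  by (simp add: norm_mult power_mult_distrib)

instantiation ell2 :: (type) real_normed_vector
begin

lift_definition zero_ell2 :: "'a ell2" is "\<lambda>_. 0"
  by simp

lift_definition uminus_ell2 :: "'a ell2 \<Rightarrow> 'a ell2" is "\<lambda>f x. - f x"
  by simp

lift_definition plus_ell2 :: "'a ell2 \<Rightarrow> 'a ell2 \<Rightarrow> 'a ell2" is "\<lambda>f g x. f x + g x"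
  by (rule square_summableI(1)) (rule L2_set_add_le)

definition minus_ell2 :: "'a ell2 \<Rightarrow> 'a ell2 \<Rightarrow> 'a ell2"
  where "f - g = f + (- g)" for f g :: "'a ell2"

lift_definition scaleR_ell2 :: "real \<Rightarrow> 'a ell2 \<Rightarrow> 'a ell2" is "\<lambda>r f x. complex_of_real r * f x"
  by (rule square_summable_scale)

lift_definition norm_ell2 :: "'a ell2 \<Rightarrow> real" is "\<lambda>f. sqrt (\<Sum>\<^sub>\<infinity>x. (cmod (f x))\<^sup>2)" .

definition dist_ell2 :: "'a ell2 \<Rightarrow> 'a ell2 \<Rightarrow> real"
  where "dist f g = norm (f - g)" for f g :: "'a ell2"

definition sgn_ell2 :: "'a ell2 \<Rightarrow> 'a ell2"
  where "sgn f = inverse (norm f) *\<^sub>R f" for f :: "'a ell2"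

definition uniformity_ell2 :: "('a ell2 \<times> 'a ell2) filter"
  where "uniformity_ell2 = (INF e\<in>{0 <..}. principal {(x, y). dist x y < e})"

definition open_ell2 :: "'a ell2 set \<Rightarrow> bool"
  where "open_ell2 U = (\<forall>x\<in>U. \<forall>\<^sub>F (x', y) in uniformity. x' = x \<longrightarrow> y \<in> U)"

instance
proof
  fix f g h :: "'a ell2" and r s :: real
  show "f + g + h = f + (g + h)" by transfer (simp add: add.assoc)
  show "f + g = g + f" by transfer (simp add: add.commute)
  show "0 + f = f" by transfer simp
  show "- f + f = 0" by transfer simp
  show "f - g = f + - g" by (rule minus_ell2_def)
  show "r *\<^sub>R (f + g) = r *\<^sub>R f + r *\<^sub>R g" by transfer (simp add: distrib_left)
  show "(r + s) *\<^sub>R f = r *\<^sub>R f + s *\<^sub>R f" by transfer (simp add: distrib_right)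
  show "r *\<^sub>R s *\<^sub>R f = (r * s) *\<^sub>R f" by transfer (simp add: mult.assoc)
  show "1 *\<^sub>R f = f" by transfer simp
  show "dist f g = norm (f - g)" by (rule dist_ell2_def)
  show "sgn f = inverse (norm f) *\<^sub>R f" by (rule sgn_ell2_def)
  show "uniformity = (INF e\<in>{0 <..}. principal {(x, y::'a ell2). dist x y < e})"
    by (rule uniformity_ell2_def)
  show "open U = (\<forall>x\<in>U. \<forall>\<^sub>F (x', y) in uniformity. x' = x \<longrightarrow> y \<in> U)" for U :: "'a ell2 set"
    by (rule open_ell2_def)
  show "norm f = 0 \<longleftrightarrow> f = 0"
  proof
    assume "norm f = 0"
    then show "f = 0"
    proof transfer
      fix f :: "'a \<Rightarrow> complex"
      assume summ: "(\<lambda>x. (cmod (f x))\<^sup>2) summable_on UNIV"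
        and eq: "sqrt (\<Sum>\<^sub>\<infinity>x. (cmod (f x))\<^sup>2) = 0"
      show "f = (\<lambda>_. 0)"
      proof
        fix x
        show "f x = 0" using L2_set_le_infsum[OF summ, of "{x}"] eq by simp
      qed
    qed
  qed (transfer, simp)
  show "norm (f + g) \<le> norm f + norm g"
    by transfer (rule square_summableI(2), rule L2_set_add_le)
  show "norm (r *\<^sub>R f) = \<bar>r\<bar> * norm f"
    by transfer (simp add: norm_mult power_mult_distrib infsum_cmult_right' real_sqrt_mult)
qed

end

lift_definition ell2_scale :: "complex \<Rightarrow> 'a ell2 \<Rightarrow> 'a ell2" is "\<lambda>c f x. c * f x"
  by (rule square_summable_scale)

lift_definition delta :: "'a \<Rightarrow> 'a ell2" is "\<lambda>a x. if x = a then 1 else 0"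
proof (rule square_summableI(1))
  fix a :: 'a and F :: "'a set"
  assume F: "finite F"
  have "(\<Sum>x\<in>F. (cmod (if x = a then 1 else 0))\<^sup>2) = (\<Sum>x\<in>F. if x = a then 1 else 0)"
    by (rule sum.cong) auto
  then show "L2_set (\<lambda>x. cmod (if x = a then 1 else 0)) F \<le> 1"
    using F by (simp add: L2_set_def sum.delta)
qed

section \<open>Bounded operators\<close>

text \<open>
  The elements of the type below are the bounded \<^emph>\<open>real\<close>-linear operators. All operators used
  later lie in norm closures of complex spans of complex-linear operators, hence are
  complex-linear; the norm of this type is the operator norm.
\<close>

type_synonym 'a ell2_op = "'a ell2 \<Rightarrow>\<^sub>L 'a ell2"

lemma norm_ell2_scale: "norm (ell2_scale c f) = cmod c * norm f"
  by transfer (simp add: norm_mult power_mult_distrib infsum_cmult_right' real_sqrt_mult)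

lemma bounded_linear_ell2_scale: "bounded_linear (ell2_scale c)"
proof (rule bounded_linear_intro[where K = "cmod c"])
  fix f g :: "'a ell2" and r :: real
  show "ell2_scale c (f + g) = ell2_scale c f + ell2_scale c g"
    by transfer (simp add: distrib_left)
  show "ell2_scale c (r *\<^sub>R f) = r *\<^sub>R ell2_scale c f"
    by transfer (simp add: mult.left_commute)
  show "norm (ell2_scale c f) \<le> norm f * cmod c"
    by (simp add: norm_ell2_scale mult.commute)
qed

definition op_scale :: "complex \<Rightarrow> 'a ell2_op \<Rightarrow> 'a ell2_op"  (infixr \<open>*\<^sub>C\<close> 75)
  where "c *\<^sub>C T = Blinfun (\<lambda>f. ell2_scale c (blinfun_apply T f))"

lemma op_scale_apply: "blinfun_apply (c *\<^sub>C T) f = ell2_scale c (blinfun_apply T f)"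
  unfolding op_scale_def
  by (subst bounded_linear_Blinfun_apply)
    (rule bounded_linear_compose[OF bounded_linear_ell2_scale blinfun.bounded_linear_right],
      rule refl)

lemma vector_space_op_scale: "vector_space (op_scale :: complex \<Rightarrow> 'a ell2_op \<Rightarrow> 'a ell2_op)"
proof
  fix a b :: complex and S T :: "'a ell2_op"
  have 1: "ell2_scale a (f + g) = ell2_scale a f + ell2_scale a g" for f g :: "'a ell2"
    by transfer (simp add: distrib_left)
  have 2: "ell2_scale (a + b) f = ell2_scale a f + ell2_scale b f" for f :: "'a ell2"
    by transfer (simp add: distrib_right)
  have 3: "ell2_scale a (ell2_scale b f) = ell2_scale (a * b) f" for f :: "'a ell2"
    by transfer (simp add: mult.assoc)
  have 4: "ell2_scale 1 f = f" for f :: "'a ell2"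
    by transfer simp
  show "a *\<^sub>C (S + T) = a *\<^sub>C S + a *\<^sub>C T"
    by (rule blinfun_eqI) (simp add: op_scale_apply plus_blinfun.rep_eq 1)
  show "(a + b) *\<^sub>C T = a *\<^sub>C T + b *\<^sub>C T"
    by (rule blinfun_eqI) (simp add: op_scale_apply plus_blinfun.rep_eq 2)
  show "a *\<^sub>C b *\<^sub>C T = (a * b) *\<^sub>C T"
    by (rule blinfun_eqI) (simp add: op_scale_apply 3)
  show "1 *\<^sub>C T = T"
    by (rule blinfun_eqI) (simp add: op_scale_apply 4)
qed

definition op_span :: "'a ell2_op set \<Rightarrow> 'a ell2_op set"
  where "op_span = module.span op_scale"

section \<open>Twisted group operator algebras\<close>

definition cocycle :: "('g::group_add \<Rightarrow> 'g \<Rightarrow> complex) \<Rightarrow> bool"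
  where "cocycle \<sigma> \<longleftrightarrow>
    (\<forall>g h. cmod (\<sigma> g h) = 1) \<and>
    (\<forall>g h k. \<sigma> g h * \<sigma> (g + h) k = \<sigma> h k * \<sigma> g (h + k)) \<and>
    (\<forall>g. \<sigma> g 0 = 1 \<and> \<sigma> 0 g = 1)"

text \<open>
  The relation \<open>\<Lambda>\<^sub>\<sigma>(g) \<delta>\<^sub>h = \<sigma>(g,h) \<delta>\<^sub>g\<^sub>h\<close>, extended to all of \<open>\<ell>\<^sup>2(G)\<close>, reads
  \<open>(\<Lambda>\<^sub>\<sigma>(g) f)(k) = \<sigma>(g, g\<inverse>k) f(g\<inverse>k)\<close>; see \<open>regular_rep_delta\<close> below.
\<close>

definition regular_rep :: "('g::group_add \<Rightarrow> 'g \<Rightarrow> complex) \<Rightarrow> 'g \<Rightarrow> 'g ell2_op"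
  where "regular_rep \<sigma> g =
    Blinfun (\<lambda>f. Abs_ell2 (\<lambda>k. \<sigma> g (- g + k) * ell2_fun f (- g + k)))"

lemma bij_left_translation: "bij (\<lambda>k :: 'g::group_add. h + k)"
  by (rule bij_betw_byWitness[where f' = "\<lambda>k. - h + k"]) (auto simp flip: add.assoc)

lemma ell2_fun_regular_rep:
  assumes "cocycle \<sigma>"
  shows "ell2_fun (blinfun_apply (regular_rep \<sigma> g) f) k = \<sigma> g (- g + k) * ell2_fun f (- g + k)"
proof -
  let ?A = "\<lambda>f k. \<sigma> g (- g + k) * ell2_fun f (- g + k)"
  have unit: "cmod (\<sigma> g h) = 1" for h
    using assms by (simp add: cocycle_def)
  have sq: "(\<lambda>k. (cmod (?A f k))\<^sup>2) = (\<lambda>k. (cmod (ell2_fun f (- g + k)))\<^sup>2)" for f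
    by (simp add: norm_mult unit)
  have mem: "(\<lambda>k. (cmod (?A f k))\<^sup>2) summable_on UNIV" for f
    unfolding sq
    using summable_on_reindex_bij_betw[OF bij_left_translation[of "- g"],
        of "\<lambda>x. (cmod (ell2_fun f x))\<^sup>2"] ell2_summable[of f] by simp
  have rep: "ell2_fun (Abs_ell2 (?A f)) = ?A f" for f
    by (rule Abs_ell2_inverse) (simp add: mem)
  have norm: "norm (Abs_ell2 (?A f)) = norm f" for f
    unfolding norm_ell2.rep_eq rep sq
    using infsum_reindex_bij_betw[OF bij_left_translation[of "- g"],
        of "\<lambda>x. (cmod (ell2_fun f x))\<^sup>2"] by simp
  have "bounded_linear (\<lambda>f. Abs_ell2 (?A f))"
  proof (rule bounded_linear_intro[where K = 1])
    fix f h :: "'a ell2" and r :: real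
    show "Abs_ell2 (?A (f + h)) = Abs_ell2 (?A f) + Abs_ell2 (?A h)"
      unfolding ell2_fun_inject[symmetric] plus_ell2.rep_eq[of "Abs_ell2 _"] rep
      by (simp only: plus_ell2.rep_eq distrib_left)
    show "Abs_ell2 (?A (r *\<^sub>R f)) = r *\<^sub>R Abs_ell2 (?A f)"
      unfolding ell2_fun_inject[symmetric] rep
      by (simp only: scaleR_ell2.rep_eq rep mult.left_commute)
    show "norm (Abs_ell2 (?A f)) \<le> norm f * 1"
      by (simp add: norm)
  qed
  then show ?thesis
    by (simp add: regular_rep_def bounded_linear_Blinfun_apply rep)
qed

lemma regular_rep_delta:
  assumes "cocycle \<sigma>"
  shows "blinfun_apply (regular_rep \<sigma> g) (delta h) = ell2_scale (\<sigma> g h) (delta (g + h))"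
proof -
  have "- g + k = h \<longleftrightarrow> k = g + h" for k
    by (metis add.assoc add.left_inverse add.right_inverse add_0)
  then show ?thesis
    by (auto simp: ell2_fun_inject[symmetric] ell2_fun_regular_rep[OF assms] ell2_scale.rep_eq
        delta.rep_eq fun_eq_iff)
qed

definition reduced_algebra :: "('g::group_add \<Rightarrow> 'g \<Rightarrow> complex) \<Rightarrow> 'g ell2_op set"
  where "reduced_algebra \<sigma> = closure (op_span (range (regular_rep \<sigma>)))"

definition fourier :: "'g::group_add ell2_op \<Rightarrow> 'g ell2"
  where "fourier x = blinfun_apply x (delta 0)"

text \<open>
  \<open>summable_on\<close> is exactly convergence of the net of finite partial sums, here in operator norm.
\<close>

definition CF :: "('g::group_add \<Rightarrow> 'g \<Rightarrow> complex) \<Rightarrow> 'g ell2_op set"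
  where "CF \<sigma> = {x \<in> reduced_algebra \<sigma>.
    (\<lambda>g. ell2_fun (fourier x) g *\<^sub>C regular_rep \<sigma> g) summable_on UNIV}"

section \<open>Multipliers\<close>

text \<open>
  \<open>M\<close> restricts to a bounded complex-linear operator on the reduced algebra with symbol \<open>\<phi>\<close>.
  Its values outside the reduced algebra are irrelevant.
\<close>

definition is_multiplier_op ::
  "('g::group_add \<Rightarrow> 'g \<Rightarrow> complex) \<Rightarrow> ('g \<Rightarrow> complex) \<Rightarrow> ('g ell2_op \<Rightarrow> 'g ell2_op) \<Rightarrow> bool"
  where "is_multiplier_op \<sigma> \<phi> M \<longleftrightarrow>
    (\<forall>x\<in>reduced_algebra \<sigma>. M x \<in> reduced_algebra \<sigma>) \<and>
    (\<forall>x\<in>reduced_algebra \<sigma>. \<forall>y\<in>reduced_algebra \<sigma>. M (x + y) = M x + M y) \<and>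
    (\<forall>c. \<forall>x\<in>reduced_algebra \<sigma>. M (c *\<^sub>C x) = c *\<^sub>C M x) \<and>
    (\<exists>K. \<forall>x\<in>reduced_algebra \<sigma>. norm (M x) \<le> K * norm x) \<and>
    (\<forall>g. M (regular_rep \<sigma> g) = \<phi> g *\<^sub>C regular_rep \<sigma> g)"

definition MA :: "('g::group_add \<Rightarrow> 'g \<Rightarrow> complex) \<Rightarrow> ('g \<Rightarrow> complex) set"
  where "MA \<sigma> = {\<phi>. bounded (range \<phi>) \<and> (\<exists>M. is_multiplier_op \<sigma> \<phi> M)}"

text \<open>
  For \<open>\<phi>\<close> in \<open>MA \<sigma>\<close> the choice below is unique on the reduced algebra; see
  \<open>multiplier_op_unique\<close>.
\<close>

definition multiplier_op ::
  "('g::group_add \<Rightarrow> 'g \<Rightarrow> complex) \<Rightarrow> ('g \<Rightarrow> complex) \<Rightarrow> 'g ell2_op \<Rightarrow> 'g ell2_op"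
  where "multiplier_op \<sigma> \<phi> = (SOME M. is_multiplier_op \<sigma> \<phi> M)"

lemma op_span_subspace: "module.subspace op_scale (op_span S)"
proof -
  interpret op: vector_space op_scale by (rule vector_space_op_scale)
  show ?thesis unfolding op_span_def by (rule op.subspace_span)
qed

lemma norm_op_scale_le: "norm (c *\<^sub>C (T :: 'a ell2_op)) \<le> cmod c * norm T"
proof (rule norm_blinfun_bound)
  fix f
  have "cmod c * norm (blinfun_apply T f) \<le> cmod c * (norm T * norm f)"
    by (intro mult_left_mono norm_blinfun) simp
  then show "norm (blinfun_apply (c *\<^sub>C T) f) \<le> cmod c * norm T * norm f"
    by (simp add: op_scale_apply norm_ell2_scale mult.assoc)
qed simp

lemma multiplier_op_unique:
  assumes M: "is_multiplier_op \<sigma> \<phi> M" and N: "is_multiplier_op \<sigma> \<phi> N"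
    and x: "x \<in> reduced_algebra \<sigma>"
  shows "M x = N x"
proof -
  interpret op: vector_space op_scale by (rule vector_space_op_scale)
  let ?S = "op_span (range (regular_rep \<sigma>))"
  let ?A = "reduced_algebra \<sigma>"
  have sub: "?S \<subseteq> ?A"
    by (simp add: reduced_algebra_def closure_subset)
  have bd: "\<exists>K. \<forall>y\<in>?A. \<forall>z\<in>?S. norm (P y - P z) \<le> K * norm (y - z)"
    if P: "is_multiplier_op \<sigma> \<phi> P" for P
  proof -
    obtain K where K: "\<And>x. x \<in> ?A \<Longrightarrow> norm (P x) \<le> K * norm x"
      using P unfolding is_multiplier_op_def by blast
    have "norm (P y - P z) \<le> K * norm (y - z)" if y: "y \<in> ?A" and z: "z \<in> ?S" for y z
    proof -
      have "y - z \<in> ?A"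
      proof -
        obtain s where s: "\<And>n. s n \<in> ?S" "s \<longlonglongrightarrow> y"
          using y unfolding reduced_algebra_def closure_sequential by blast
        have "(\<lambda>n. s n - z) \<longlonglongrightarrow> y - z"
          by (intro tendsto_intros s)
        moreover have "s n - z \<in> ?S" for n
          by (rule op.subspace_diff[OF op_span_subspace s(1) z])
        ultimately show ?thesis
          unfolding reduced_algebra_def closure_sequential
          by (intro exI[of _ "\<lambda>n. s n - z"]) simp
      qed
      moreover have "P y = P (y - z) + P z"
        using P calculation sub z unfolding is_multiplier_op_def
        by (metis diff_add_cancel subsetD)
      ultimately show ?thesis
        using K[of "y - z"] by simp
    qed
    then show ?thesis by blast
  qed
  have eqS: "M z = N z" if "z \<in> ?S" for z
  proof -
    have "z \<in> op.span (range (regular_rep \<sigma>))"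
      using that by (simp add: op_span_def)
    then have "z \<in> ?S \<and> M z = N z"
    proof (induction rule: op.span_induct_alt)
      case base
      have "0 \<in> ?S"
        by (rule op.subspace_0[OF op_span_subspace])
      moreover from this have "0 \<in> ?A"
        using sub by blast
      ultimately show ?case
        using M N unfolding is_multiplier_op_def by (metis op.scale_zero_left)
    next
      case (step c w y)
      then obtain g where g: "w = regular_rep \<sigma> g" by blast
      have w: "w \<in> ?S"
        using step(1) by (simp add: op_span_def op.span_base)
      have cw: "c *\<^sub>C w \<in> ?S"
        by (rule op.subspace_scale[OF op_span_subspace w])
      have cwy: "c *\<^sub>C w + y \<in> ?S"
        using op.subspace_add[OF op_span_subspace cw] step by blast
      have "P (c *\<^sub>C w + y) = c *\<^sub>C \<phi> g *\<^sub>C w + P y" if "is_multiplier_op \<sigma> \<phi> P" for P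
        using that w cw step sub unfolding is_multiplier_op_def g by (metis subsetD)
      from this[OF M] this[OF N] show ?case
        using cwy step(2) by simp
    qed
    then show ?thesis ..
  qed
  obtain K1 K2 where K: "\<And>y z. y \<in> ?A \<Longrightarrow> z \<in> ?S \<Longrightarrow> norm (M y - M z) \<le> K1 * norm (y - z)"
      "\<And>y z. y \<in> ?A \<Longrightarrow> z \<in> ?S \<Longrightarrow> norm (N y - N z) \<le> K2 * norm (y - z)"
    using bd[OF M] bd[OF N] by metis
  obtain s where s: "\<And>n. s n \<in> ?S" "s \<longlonglongrightarrow> x"
    using x unfolding reduced_algebra_def closure_sequential by blast
  have lim: "(\<lambda>n. K * norm (x - s n)) \<longlonglongrightarrow> 0" for K
    using tendsto_mult_left[OF tendsto_norm[OF tendsto_diff[OF tendsto_const[of x] s(2)]], of K]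
    by simp
  have "norm (M x - N x) \<le> K1 * norm (x - s n) + K2 * norm (x - s n)" for n
  proof -
    have "norm (M x - N x) = norm ((M x - M (s n)) - (N x - N (s n)))"
      using eqS[OF s(1)[of n]] by simp
    also have "\<dots> \<le> norm (M x - M (s n)) + norm (N x - N (s n))"
      by (rule norm_triangle_ineq4)
    finally show ?thesis
      using K(1)[OF x s(1)[of n]] K(2)[OF x s(1)[of n]] by linarith
  qed
  then have "norm (M x - N x) \<le> 0 + 0"
    by (intro tendsto_lowerbound[OF tendsto_add[OF lim lim]]) (auto intro: always_eventually)
  then show ?thesis by simp
qed

definition MCF :: "('g::group_add \<Rightarrow> 'g \<Rightarrow> complex) \<Rightarrow> ('g \<Rightarrow> complex) set"
  where "MCF \<sigma> = {\<phi> \<in> MA \<sigma>. multiplier_op \<sigma> \<phi> ` reduced_algebra \<sigma> \<subseteq> CF \<sigma>}"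

section \<open>Negative definite functions and the heat property\<close>

definition ND0_plus :: "('g::group_add \<Rightarrow> real) set"
  where "ND0_plus = {d.
    (\<forall>g. 0 \<le> d g) \<and> d 0 = 0 \<and> (\<forall>g. d (- g) = d g) \<and>
    (\<forall>n. \<forall>g :: nat \<Rightarrow> 'g. \<forall>b :: nat \<Rightarrow> complex. (\<Sum>i<n. b i) = 0 \<longrightarrow>
      (\<Sum>i<n. \<Sum>j<n. cnj (b i) * b j * complex_of_real (d (- g i + g j))) \<in> \<real>\<^sub>\<le>\<^sub>0)}"

definition heat_symbol :: "('g \<Rightarrow> real) \<Rightarrow> real \<Rightarrow> 'g \<Rightarrow> complex"
  where "heat_symbol d t g = complex_of_real (exp (- t * d g))"

definition heat_epsilon :: "('g::group_add \<Rightarrow> real) \<Rightarrow> ('g \<Rightarrow> 'g \<Rightarrow> complex) \<Rightarrow> ennreal"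
  where "heat_epsilon d \<sigma> = Inf {ennreal t | t. 0 < t \<and> heat_symbol d t \<in> MCF \<sigma>}"

definition heat_property :: "('g::group_add \<Rightarrow> 'g \<Rightarrow> complex) \<Rightarrow> ('g \<Rightarrow> real) \<Rightarrow> bool"
  where "heat_property \<sigma> d \<longleftrightarrow> (\<forall>t>0. heat_symbol d t \<in> MCF \<sigma>)"

section \<open>Haagerup content and growth\<close>

definition proper_length :: "('g \<Rightarrow> real) \<Rightarrow> bool"
  where "proper_length L \<longleftrightarrow> (\<forall>r\<ge>0. finite {g. L g \<le> r})"

definition group_algebra :: "'g::group_add ell2_op set"
  where "group_algebra = op_span (range (regular_rep (\<lambda>_ _. 1)))"

text \<open>
  For finite nonempty \<open>E\<close> the set below is nonempty and bounded above (by the square root of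
  \<open>card E\<close>), so the supremum in the reals is the intended one. It is only used for such \<open>E\<close>.
\<close>

definition haagerup_content :: "'g::group_add set \<Rightarrow> real"
  where "haagerup_content E =
    Sup {norm x | x. x \<in> group_algebra \<and> {g. ell2_fun (fourier x) g \<noteq> 0} \<subseteq> E
                     \<and> norm (fourier x) \<le> 1}"

text \<open>Meaningful for proper \<open>L\<close> with \<open>L 0 = 0\<close>.\<close>

definition subexponential_H_growth :: "('g::group_add \<Rightarrow> real) \<Rightarrow> bool"
  where "subexponential_H_growth L \<longleftrightarrow>
    (\<forall>b>1. \<exists>r1\<ge>0. \<forall>r\<ge>r1. haagerup_content {g. L g \<le> r} < b powr r)"

end

theory Submission
  imports Defs
begin

text \<open>
  The norm of \<open>\<Sum> a(g) \<Lambda>\<^sub>\<sigma>(g)\<close> is at most that of the untwisted sum \<open>\<Sum> \<bar>a(g)\<bar> \<lambda>(g)\<close>, so for \<open>a\<close> supported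
  in a finite set \<open>E\<close> the operator \<open>\<Sum> a(g) \<Lambda>\<^sub>\<sigma>(g)\<close> has norm at most \<open>c(E) \<parallel>a\<parallel>\<^sub>2\<close>. Splitting
  \<open>G\<close> into the annuli \<open>n - 1 < d \<le> n\<close> and using subexponential growth bounds every finite sum
  \<open>\<Sum> exp (- t d(g)) a(g) \<Lambda>\<^sub>\<sigma>(g)\<close> by a constant times \<open>\<parallel>a\<parallel>\<^sub>2\<close>. With \<open>a\<close> the Fourier coefficients of \<open>x\<close>
  the series is therefore unordered Cauchy, and its sum defines the multiplier operator directly,
  without Schoenberg's theorem.
\<close>

section \<open>Unordered sums\<close>

text \<open>Only finitely many indices carry more than a small part of the total of
  \<open>w\<close>. The hypothesis, applied to finite sets avoiding these, makes the partial sums of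
  \<open>u\<close> a Cauchy net.\<close>

lemma summable_on_square_dominated:
  fixes u :: "'i \<Rightarrow> 'b::banach" and w :: "'i \<Rightarrow> real"
  assumes w: "w summable_on UNIV" and w_nonneg: "\<And>i. 0 \<le> w i"
    and C: "0 \<le> C"
    and le: "\<And>F. finite F \<Longrightarrow> norm (sum u F) \<le> C * sqrt (sum w F)"
  shows "u summable_on UNIV"
    and "norm (infsum u UNIV) \<le> C * sqrt (infsum w UNIV)"
proof -
  have "\<exists>P. eventually P (finite_subsets_at_top UNIV) \<and>
          (\<forall>F F'. P F \<and> P F' \<longrightarrow> dist (sum u F) (sum u F') < e)" if e: "0 < e" for e
  proof -
    \<comment> \<open>The denominator uses \<open>C + 1\<close> so that \<open>C = 0\<close> causes
      no division by zero.\<close>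
    define \<delta> where "\<delta> = e / (4 * (C + 1))"
    have \<delta>: "0 < \<delta>" "C * \<delta> \<le> e / 4"
      using e C by (simp_all add: \<delta>_def field_simps)
    obtain F0 where F0: "finite F0" "dist (sum w F0) (infsum w UNIV) < \<delta>\<^sup>2"
      using tendstoD[OF infsum_tendsto[OF w], of "\<delta>\<^sup>2"] \<delta>(1)
      unfolding eventually_finite_subsets_at_top by auto
    \<comment> \<open>The difference is the sum over \<open>F - F0\<close>, where \<open>w\<close>
      has mass at most \<open>\<delta>\<^sup>2\<close>.\<close>
    have near: "dist (sum u F) (sum u F0) \<le> e / 4" if F: "finite F" "F0 \<subseteq> F" for F
    proof -
      have "sum w F \<le> infsum w UNIV"
        by (rule finite_sum_le_infsum) (use w w_nonneg F in auto)
      then have "sum w (F - F0) \<le> \<delta>\<^sup>2"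
        using F0(2) F by (simp add: sum_diff dist_real_def abs_real_def split: if_splits)
      then have "sqrt (sum w (F - F0)) \<le> \<delta>"
        using \<delta>(1) by (simp add: real_le_lsqrt)
      then have "C * sqrt (sum w (F - F0)) \<le> e / 4"
        using \<delta>(2) C by (meson mult_left_mono order_trans)
      then show ?thesis
        using le[of "F - F0"] F by (simp add: dist_norm sum_diff)
    qed
    have "eventually (\<lambda>F. finite F \<and> F0 \<subseteq> F) (finite_subsets_at_top UNIV)"
      unfolding eventually_finite_subsets_at_top using F0(1) by blast
    moreover have "dist (sum u F) (sum u F') < e"
      if "finite F \<and> F0 \<subseteq> F" "finite F' \<and> F0 \<subseteq> F'" for F F'
      using near[of F] near[of F'] that e
        dist_triangle2[of "sum u F" "sum u F'" "sum u F0"] by auto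
    ultimately show ?thesis by blast
  qed
  then have "cauchy_filter (filtermap (sum u) (finite_subsets_at_top UNIV))"
    by (simp add: cauchy_filter_metric_filtermap)
  moreover have "complete (UNIV::'b set)"
    by (meson Cauchy_convergent UNIV_I complete_def convergent_def)
  ultimately obtain L where "(sum u \<longlongrightarrow> L) (finite_subsets_at_top UNIV)"
    using complete_uniform[where S = UNIV] by (force simp: filterlim_def)
  then show summ: "u summable_on UNIV"
    using summable_on_def has_sum_def by blast
  \<comment> \<open>The finite estimates pass to the limit because norm and square root are
    continuous.\<close>
  show "norm (infsum u UNIV) \<le> C * sqrt (infsum w UNIV)"
    by (rule tendsto_le[OF _ tendsto_mult[OF tendsto_const tendsto_real_sqrt[OF infsum_tendsto[OF w]]]
          tendsto_norm[OF infsum_tendsto[OF summ]]])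
      (auto intro: le)
qed

section \<open>Completeness of the sequence space\<close>

lemma ell2_fun_sum: "ell2_fun (sum f F) k = (\<Sum>i\<in>F. ell2_fun (f i) k)"
  by (induction F rule: infinite_finite_induct) (simp_all add: zero_ell2.rep_eq plus_ell2.rep_eq)

lemma ell2_fun_diff: "ell2_fun (f - g) k = ell2_fun f k - ell2_fun g k"
  unfolding minus_ell2_def plus_ell2.rep_eq uminus_ell2.rep_eq by simp

lemma L2_set_le_norm_ell2:
  assumes "finite F"
  shows "L2_set (\<lambda>k. cmod (ell2_fun f k)) F \<le> norm f"
  using L2_set_le_infsum[OF ell2_summable assms] by (simp add: norm_ell2.rep_eq)

lemma norm_ell2_leI:
  assumes "\<And>F. finite F \<Longrightarrow> L2_set (\<lambda>k. cmod (ell2_fun f k)) F \<le> C"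
  shows "norm f \<le> C"
  using square_summableI(2)[OF assms] by (simp add: norm_ell2.rep_eq)

lemma norm_ell2_mono:
  assumes "\<And>k. cmod (ell2_fun f k) \<le> cmod (ell2_fun g k)"
  shows "norm f \<le> norm g"
proof (rule norm_ell2_leI)
  fix F :: "'a set"
  assume F: "finite F"
  have "L2_set (\<lambda>k. cmod (ell2_fun f k)) F \<le> L2_set (\<lambda>k. cmod (ell2_fun g k)) F"
    by (rule L2_set_mono) (simp_all add: assms)
  also have "\<dots> \<le> norm g"
    by (rule L2_set_le_norm_ell2[OF F])
  finally show "L2_set (\<lambda>k. cmod (ell2_fun f k)) F \<le> norm g" .
qed

lemma cmod_ell2_fun_le: "cmod (ell2_fun f k) \<le> norm f"
  using L2_set_le_norm_ell2[of "{k}" f] by simp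

lemma norm_ell2_finite_support:
  assumes "finite F" and "\<And>k. k \<notin> F \<Longrightarrow> ell2_fun f k = 0"
  shows "norm f = L2_set (\<lambda>k. cmod (ell2_fun f k)) F"
proof -
  have "(\<Sum>\<^sub>\<infinity>k. (cmod (ell2_fun f k))\<^sup>2) = (\<Sum>\<^sub>\<infinity>k\<in>F. (cmod (ell2_fun f k))\<^sup>2)"
    by (rule infsum_cong_neutral) (use assms(2) in auto)
  then show ?thesis
    using assms(1) by (simp add: norm_ell2.rep_eq L2_set_def)
qed

lemma bounded_linear_ell2_fun: "bounded_linear (\<lambda>f. ell2_fun f k)"
  by (rule bounded_linear_intro[where K = 1])
    (simp_all add: plus_ell2.rep_eq scaleR_ell2.rep_eq cmod_ell2_fun_le scaleR_conv_of_real)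

text \<open>Completeness carries over to the bounded operators on this space, which allows
  \<open>summable_on_square_dominated\<close> to be applied to operator-valued series. The limit is
  built coordinatewise.\<close>

instance ell2 :: (type) banach
proof
  fix X :: "nat \<Rightarrow> 'a ell2"
  assume X: "Cauchy X"
  have "Cauchy (\<lambda>n. ell2_fun (X n) k)" for k
    by (rule bounded_linear.Cauchy[OF bounded_linear_ell2_fun X])
  then have "\<forall>k. \<exists>l. (\<lambda>n. ell2_fun (X n) k) \<longlonglongrightarrow> l"
    by (simp add: Cauchy_convergent_iff convergent_def)
  then obtain l where l: "\<And>k. (\<lambda>n. ell2_fun (X n) k) \<longlonglongrightarrow> l k"
    by metis
  \<comment> \<open>On a finite set coordinatewise convergence suffices to let \<open>m\<close> tend
    to infinity in the Cauchy estimate.\<close>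
  have tail: "L2_set (\<lambda>k. cmod (l k - ell2_fun (X n) k)) F \<le> e"
    if N: "\<forall>m\<ge>N. \<forall>n\<ge>N. norm (X m - X n) < e" and "n \<ge> N" "finite F" for N n e F
  proof (rule tendsto_upperbound)
    show "(\<lambda>m. L2_set (\<lambda>k. cmod (ell2_fun (X m) k - ell2_fun (X n) k)) F)
            \<longlonglongrightarrow> L2_set (\<lambda>k. cmod (l k - ell2_fun (X n) k)) F"
      unfolding L2_set_def by (intro tendsto_intros l)
    show "\<forall>\<^sub>F m in sequentially. L2_set (\<lambda>k. cmod (ell2_fun (X m) k - ell2_fun (X n) k)) F \<le> e"
      using eventually_ge_at_top[of N]
    proof eventually_elim
      case (elim m)
      then have "norm (X m - X n) < e"
        using N \<open>n \<ge> N\<close> by blast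
      then show ?case
        using L2_set_le_norm_ell2[OF \<open>finite F\<close>, of "X m - X n"] by (simp add: ell2_fun_diff)
    qed
  qed simp
  obtain N1 where N1: "\<forall>m\<ge>N1. \<forall>n\<ge>N1. norm (X m - X n) < 1"
    using X unfolding Cauchy_iff by (metis zero_less_one)
  \<comment> \<open>Square-summability of \<open>l\<close> itself is not yet available, but
    \<open>tail\<close> bounds its difference from \<open>X N1\<close>; adding \<open>X N1\<close>
    back gives the limit.\<close>
  define h where "h = Abs_ell2 (\<lambda>k. l k - ell2_fun (X N1) k)"
  have h: "ell2_fun h = (\<lambda>k. l k - ell2_fun (X N1) k)"
    unfolding h_def
    by (rule Abs_ell2_inverse) (simp add: square_summableI(1)[OF tail[OF N1 order_refl]])
  have "X \<longlonglongrightarrow> h + X N1"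
  proof (rule LIMSEQ_I)
    fix e :: real
    assume e: "0 < e"
    then obtain N where N: "\<forall>m\<ge>N. \<forall>n\<ge>N. norm (X m - X n) < e / 2"
      using X unfolding Cauchy_iff by (metis half_gt_zero)
    have "norm (X n - (h + X N1)) < e" if "n \<ge> N" for n
    proof -
      have "norm ((h + X N1) - X n) \<le> e / 2"
        using tail[OF N that] by (intro norm_ell2_leI) (simp add: ell2_fun_diff plus_ell2.rep_eq h)
      then show ?thesis
        using e by (simp add: norm_minus_commute)
    qed
    then show "\<exists>N. \<forall>n\<ge>N. norm (X n - (h + X N1)) < e" by blast
  qed
  then show "convergent X" by (rule convergentI)
qed

section \<open>Fourier coefficients\<close>

text \<open>This lets complex scalars be pulled out of infinite operator sums, although the operator
  type is only a real normed space.\<close>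

lemma bounded_linear_op_scale: "bounded_linear (op_scale c)"
proof (rule bounded_linear_intro[where K = "cmod c"])
  interpret op: vector_space op_scale by (rule vector_space_op_scale)
  fix S T :: "'a ell2_op" and r :: real
  show "c *\<^sub>C (S + T) = c *\<^sub>C S + c *\<^sub>C T"
    by (rule op.scale_right_distrib)
  show "c *\<^sub>C (r *\<^sub>R T) = r *\<^sub>R (c *\<^sub>C T)"
    by (rule blinfun_eqI)
      (simp add: op_scale_apply scaleR_blinfun.rep_eq
        bounded_linear.linear[OF bounded_linear_ell2_scale, THEN linear_scale])
  show "norm (c *\<^sub>C T) \<le> norm T * cmod c"
    using norm_op_scale_le[of c T] by (simp add: mult.commute)
qed

lemma ell2_fun_op_scale:
  "ell2_fun (blinfun_apply (c *\<^sub>C T) f) k = c * ell2_fun (blinfun_apply T f) k"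
  by (simp add: op_scale_apply ell2_scale.rep_eq)

lemma ell2_fun_op_sum:
  "ell2_fun (blinfun_apply (\<Sum>i\<in>F. c i *\<^sub>C T i) f) k = (\<Sum>i\<in>F. c i * ell2_fun (blinfun_apply (T i) f) k)"
  by (simp add: blinfun.sum_left ell2_fun_sum ell2_fun_op_scale)

lemma norm_delta: "norm (delta a) = 1"
  by (subst norm_ell2_finite_support[of "{a}"]) (simp_all add: delta.rep_eq)

lemma norm_fourier_le: "norm (fourier x) \<le> norm x"
  using norm_blinfun[of x "delta 0"] by (simp add: fourier_def norm_delta)

lemma bounded_linear_fourier_coeff: "bounded_linear (\<lambda>x. ell2_fun (fourier x) g)"
  unfolding fourier_def
  by (rule bounded_linear_compose[OF bounded_linear_ell2_fun blinfun.bounded_linear_left])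

lemma fourier_op_scale: "ell2_fun (fourier (c *\<^sub>C x)) g = c * ell2_fun (fourier x) g"
  by (simp add: fourier_def ell2_fun_op_scale)

lemma fourier_regular_rep:
  assumes "cocycle \<sigma>"
  shows "ell2_fun (fourier (regular_rep \<sigma> g)) k = (if k = g then 1 else 0)"
  using assms by (simp add: fourier_def regular_rep_delta ell2_scale.rep_eq delta.rep_eq cocycle_def)

lemma fourier_sum_regular_rep:
  assumes "cocycle \<sigma>" "finite F"
  shows "ell2_fun (fourier (\<Sum>g\<in>F. a g *\<^sub>C regular_rep \<sigma> g)) k = (if k \<in> F then a k else 0)"
proof -
  have "ell2_fun (fourier (\<Sum>g\<in>F. a g *\<^sub>C regular_rep \<sigma> g)) k
      = (\<Sum>g\<in>F. a g * ell2_fun (fourier (regular_rep \<sigma> g)) k)"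
    by (simp add: fourier_def ell2_fun_op_sum)
  also have "\<dots> = (\<Sum>g\<in>F. if k = g then a g else 0)"
    by (rule sum.cong) (simp_all add: fourier_regular_rep[OF assms(1)])
  finally show ?thesis
    using assms(2) by simp
qed

lemma sum_regular_rep_in_span:
  "(\<Sum>g\<in>F. a g *\<^sub>C regular_rep \<sigma> g) \<in> op_span (range (regular_rep \<sigma>))"
proof -
  interpret op: vector_space op_scale by (rule vector_space_op_scale)
  show ?thesis
    unfolding op_span_def by (intro op.span_sum op.span_scale op.span_base) auto
qed

text \<open>The coefficients of a finite linear combination are recovered by evaluating at
  \<open>delta 0\<close>, so a span element is determined by its Fourier coefficients.\<close>

lemma op_span_regular_rep_eq:
  assumes \<sigma>: "cocycle \<sigma>" and x: "x \<in> op_span (range (regular_rep \<sigma>))"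
    and E: "finite E" "{g. ell2_fun (fourier x) g \<noteq> 0} \<subseteq> E"
  shows "x = (\<Sum>g\<in>E. ell2_fun (fourier x) g *\<^sub>C regular_rep \<sigma> g)"
proof -
  interpret op: vector_space op_scale by (rule vector_space_op_scale)
  obtain t r where t: "finite t" "t \<subseteq> range (regular_rep \<sigma>)" and xt: "x = (\<Sum>a\<in>t. r a *\<^sub>C a)"
    using x by (auto simp: op_span_def op.span_explicit)
  \<comment> \<open>Injectivity is what turns a combination indexed by operators into one indexed by
    group elements.\<close>
  have inj: "inj (regular_rep \<sigma>)"
  proof (rule injI)
    fix g h
    assume "regular_rep \<sigma> g = regular_rep \<sigma> h"
    then have "ell2_fun (fourier (regular_rep \<sigma> g)) g = ell2_fun (fourier (regular_rep \<sigma> h)) g"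
      by simp
    then show "g = h"
      by (simp add: fourier_regular_rep[OF \<sigma>] split: if_splits)
  qed
  obtain T where T: "t = regular_rep \<sigma> ` T" "finite T"
    using t by (meson finite_subset_image)
  define a where "a g = r (regular_rep \<sigma> g)" for g
  have xT: "x = (\<Sum>g\<in>T. a g *\<^sub>C regular_rep \<sigma> g)"
    unfolding xt T(1) a_def using inj by (subst sum.reindex) (auto intro: inj_on_subset)
  have coeff: "ell2_fun (fourier x) k = (if k \<in> T then a k else 0)" for k
    unfolding xT by (rule fourier_sum_regular_rep[OF \<sigma> T(2)])
  \<comment> \<open>Both \<open>E\<close> and \<open>T\<close> contain the support, so passing
    through \<open>E \<union> T\<close> only adds and removes zero terms.\<close>
  have "(\<Sum>g\<in>E. ell2_fun (fourier x) g *\<^sub>C regular_rep \<sigma> g)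
      = (\<Sum>g\<in>E \<union> T. ell2_fun (fourier x) g *\<^sub>C regular_rep \<sigma> g)"
    by (rule sum.mono_neutral_left) (use E T in auto)
  also have "\<dots> = (\<Sum>g\<in>T. ell2_fun (fourier x) g *\<^sub>C regular_rep \<sigma> g)"
    by (rule sum.mono_neutral_right) (use E T coeff in auto)
  also have "\<dots> = x"
    unfolding coeff by (simp add: xT cong: sum.cong)
  finally show ?thesis ..
qed

section \<open>Comparison with the untwisted representation\<close>

lift_definition ell2_abs :: "'a ell2 \<Rightarrow> 'a ell2" is "\<lambda>f x. complex_of_real (cmod (f x))"
  by simp

lemma norm_ell2_abs: "norm (ell2_abs f) = norm f"
  by transfer simp

lemma cocycle_trivial: "cocycle (\<lambda>_ _. 1)"
  by (simp add: cocycle_def)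

text \<open>
  Since \<open>\<sigma>\<close> is unimodular, the twisted sum applied to \<open>f\<close> is pointwise dominated by the untwisted
  sum with coefficients \<open>\<bar>a g\<bar>\<close> applied to \<open>\<bar>f\<bar>\<close>.
\<close>

lemma norm_twisted_sum_le:
  assumes \<sigma>: "cocycle \<sigma>"
  shows "norm (\<Sum>g\<in>F. a g *\<^sub>C regular_rep \<sigma> g)
      \<le> norm (\<Sum>g\<in>F. complex_of_real (cmod (a g)) *\<^sub>C regular_rep (\<lambda>_ _. 1) g)"
    (is "_ \<le> norm ?y")
proof (rule norm_blinfun_bound)
  fix f :: "'a ell2"
  have unit: "cmod (\<sigma> g h) = 1" for g h
    using \<sigma> by (simp add: cocycle_def)
  have "norm (blinfun_apply (\<Sum>g\<in>F. a g *\<^sub>C regular_rep \<sigma> g) f)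
      \<le> norm (blinfun_apply ?y (ell2_abs f))"
  proof (rule norm_ell2_mono)
    fix k
    have "cmod (ell2_fun (blinfun_apply (\<Sum>g\<in>F. a g *\<^sub>C regular_rep \<sigma> g) f) k)
        \<le> (\<Sum>g\<in>F. cmod (a g) * cmod (ell2_fun f (- g + k)))"
      unfolding ell2_fun_op_sum ell2_fun_regular_rep[OF \<sigma>]
      by (rule order_trans[OF norm_sum]) (simp add: norm_mult unit)
    also have "\<dots> = \<bar>\<Sum>g\<in>F. cmod (a g) * cmod (ell2_fun f (- g + k))\<bar>"
      by (simp add: sum_nonneg)
    also have "\<dots> = cmod (complex_of_real (\<Sum>g\<in>F. cmod (a g) * cmod (ell2_fun f (- g + k))))"
      by (simp only: norm_of_real)
    also have "complex_of_real (\<Sum>g\<in>F. cmod (a g) * cmod (ell2_fun f (- g + k)))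
        = ell2_fun (blinfun_apply ?y (ell2_abs f)) k"
      unfolding ell2_fun_op_sum ell2_fun_regular_rep[OF cocycle_trivial] by (simp add: ell2_abs.rep_eq)
    finally show "cmod (ell2_fun (blinfun_apply (\<Sum>g\<in>F. a g *\<^sub>C regular_rep \<sigma> g) f) k)
        \<le> cmod (ell2_fun (blinfun_apply ?y (ell2_abs f)) k)" .
  qed
  also have "\<dots> \<le> norm ?y * norm f"
    using norm_blinfun[of ?y "ell2_abs f"] by (simp add: norm_ell2_abs)
  finally show "norm (blinfun_apply (\<Sum>g\<in>F. a g *\<^sub>C regular_rep \<sigma> g) f) \<le> norm ?y * norm f" .
qed simp

section \<open>Haagerup content as a bound for twisted finite sums\<close>

lemma norm_regular_rep_le:
  assumes \<sigma>: "cocycle \<sigma>"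
  shows "norm (regular_rep \<sigma> g) \<le> 1"
proof (rule norm_blinfun_bound)
  fix f :: "'a ell2"
  have unit: "cmod (\<sigma> g h) = 1" for h
    using \<sigma> by (simp add: cocycle_def)
  have "norm (blinfun_apply (regular_rep \<sigma> g) f) = norm f"
    unfolding norm_ell2.rep_eq ell2_fun_regular_rep[OF \<sigma>] norm_mult unit
    using infsum_reindex_bij_betw[OF bij_left_translation[of "- g"],
        of "\<lambda>x. (cmod (ell2_fun f x))\<^sup>2"] by simp
  then show "norm (blinfun_apply (regular_rep \<sigma> g) f) \<le> 1 * norm f"
    by simp
qed simp

text \<open>A real supremum is an upper bound only for a set bounded above. The triangle inequality
  supplies the crude bound \<open>card E\<close>, as coefficients are at most 1 in modulus and
  translations are contractions.\<close>

lemma haagerup_content_upper: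
  assumes E: "finite E" and x: "x \<in> group_algebra" "{g. ell2_fun (fourier x) g \<noteq> 0} \<subseteq> E"
    "norm (fourier x) \<le> 1"
  shows "norm x \<le> haagerup_content E"
  unfolding haagerup_content_def
proof (rule cSup_upper)
  show "bdd_above {norm x | x :: 'a ell2_op. x \<in> group_algebra \<and>
      {g. ell2_fun (fourier x) g \<noteq> 0} \<subseteq> E \<and> norm (fourier x) \<le> 1}"
  proof (rule bdd_aboveI, safe)
    fix y :: "'a ell2_op"
    assume y: "y \<in> group_algebra" "{g. ell2_fun (fourier y) g \<noteq> 0} \<subseteq> E" "norm (fourier y) \<le> 1"
    have "norm y = norm (\<Sum>g\<in>E. ell2_fun (fourier y) g *\<^sub>C regular_rep (\<lambda>_ _. 1) g)"
      using op_span_regular_rep_eq[OF cocycle_trivial y(1)[unfolded group_algebra_def] E y(2)]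
      by simp
    also have "\<dots> \<le> (\<Sum>g\<in>E. 1)"
    proof (rule sum_norm_le)
      fix g
      have "cmod (ell2_fun (fourier y) g) \<le> 1"
        using cmod_ell2_fun_le[of "fourier y" g] y(3) by linarith
      then have "cmod (ell2_fun (fourier y) g) * norm (regular_rep (\<lambda>_ _. 1) g) \<le> 1"
        by (intro mult_le_one norm_regular_rep_le cocycle_trivial) auto
      then show "norm (ell2_fun (fourier y) g *\<^sub>C regular_rep (\<lambda>_ _. 1) g) \<le> 1"
        using norm_op_scale_le order_trans by blast
    qed
    finally show "norm y \<le> (\<Sum>g\<in>E. 1)" .
  qed
qed (use x in blast)

text \<open>The untwisted majorant, scaled to unit 2-norm, competes in the supremum defining the
  content. Allowing \<open>E\<close> to exceed \<open>F\<close> lets an annulus be measured by the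
  ball around it.\<close>

lemma norm_twisted_sum_le_haagerup_content:
  assumes \<sigma>: "cocycle \<sigma>" and E: "finite E" "F \<subseteq> E"
  shows "norm (\<Sum>g\<in>F. a g *\<^sub>C regular_rep \<sigma> g) \<le> haagerup_content E * L2_set (\<lambda>g. cmod (a g)) F"
proof -
  have F: "finite F"
    using E by (rule rev_finite_subset)
  define s where "s = L2_set (\<lambda>g. cmod (a g)) F"
  define b where "b g = complex_of_real (cmod (a g))" for g
  define y where "y = (\<Sum>g\<in>F. b g *\<^sub>C regular_rep (\<lambda>_ _. 1) g)"
  have coeff: "ell2_fun (fourier y) k = (if k \<in> F then b k else 0)" for k
    unfolding y_def by (rule fourier_sum_regular_rep[OF cocycle_trivial F])
  have norm_y: "norm (fourier y) = s"
    unfolding s_def using F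
    by (subst norm_ell2_finite_support[of F]) (auto simp: coeff b_def L2_set_def)
  have y: "y \<in> group_algebra"
    unfolding y_def group_algebra_def by (rule sum_regular_rep_in_span)
  have "norm y \<le> haagerup_content E * s"
  \<comment> \<open>With \<open>s = 0\<close> no scaling is possible, but then all Fourier
    coefficients vanish and \<open>y\<close> is an empty sum.\<close>
  proof (cases "s = 0")
    case True
    then have "fourier y = 0"
      using norm_y by simp
    then have "y = (\<Sum>g\<in>{}. ell2_fun (fourier y) g *\<^sub>C regular_rep (\<lambda>_ _. 1) g)"
      by (intro op_span_regular_rep_eq[OF cocycle_trivial y[unfolded group_algebra_def]])
        (simp_all add: zero_ell2.rep_eq)
    then show ?thesis
      using True by simp
  next
    case False
    interpret op: vector_space op_scale by (rule vector_space_op_scale)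
    have s: "0 < s"
      using False by (simp add: s_def order.not_eq_order_implies_strict L2_set_nonneg)
    define z where "z = complex_of_real (1 / s) *\<^sub>C y"
    have "fourier z = ell2_scale (complex_of_real (1 / s)) (fourier y)"
      by (simp add: z_def fourier_def op_scale_apply)
    then have "norm (fourier z) \<le> 1"
      using s by (simp add: norm_ell2_scale norm_y norm_divide)
    moreover have "z \<in> group_algebra"
      using op.subspace_scale[OF op_span_subspace] y by (simp add: z_def group_algebra_def)
    moreover have "{g. ell2_fun (fourier z) g \<noteq> 0} \<subseteq> E"
      using E(2) by (auto simp: z_def fourier_op_scale coeff split: if_splits)
    ultimately have z: "norm z \<le> haagerup_content E"
      using haagerup_content_upper[OF E(1)] by blast
    have "y = complex_of_real s *\<^sub>C z"
      using s by (simp add: z_def)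
    then have "norm y \<le> s * norm z"
      using norm_op_scale_le[of "complex_of_real s" z] s by simp
    also have "\<dots> \<le> s * haagerup_content E"
      using s z by simp
    finally show ?thesis
      by (simp add: mult.commute)
  qed
  then show ?thesis
    using norm_twisted_sum_le[OF \<sigma>, of a F] unfolding y_def b_def s_def by linarith
qed

section \<open>The heat multipliers\<close>

text \<open>Growth controls only large radii; the finitely many smaller integer radii are absorbed
  into the constant.\<close>

lemma subexponential_ball_bound:
  assumes "subexponential_H_growth L" "1 < b"
  obtains K where "0 \<le> K" "\<And>n::nat. haagerup_content {g. L g \<le> real n} \<le> K * b ^ n"
proof -
  define c where "c n = haagerup_content {g. L g \<le> real n}" for n :: nat
  obtain r where r: "\<And>s. s \<ge> r \<Longrightarrow> haagerup_content {g. L g \<le> s} < b powr s"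
    using assms unfolding subexponential_H_growth_def by metis
  define N where "N = nat \<lceil>r\<rceil>"
  \<comment> \<open>The summand 1 makes the same \<open>K\<close> serve for large \<open>n\<close>;
    absolute values avoid any appeal to the sign of the content.\<close>
  define K where "K = 1 + (\<Sum>n<N. \<bar>c n\<bar>)"
  have K: "1 \<le> K"
    by (simp add: K_def sum_nonneg)
  have "c n \<le> K * b ^ n" for n
  proof (cases "n < N")
    case True
    then have "\<bar>c n\<bar> \<le> (\<Sum>n<N. \<bar>c n\<bar>)"
      by (intro member_le_sum) auto
    then have "c n \<le> K"
      unfolding K_def by linarith
    also have "\<dots> \<le> K * b ^ n"
      using K assms(2) by (simp add: mult_le_cancel_left1 one_le_power)
    finally show ?thesis .
  next
    case False
    then have "r \<le> real n"
      unfolding N_def by linarith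
    then have "c n \<le> b ^ n"
      using r[of "real n"] assms(2) by (simp add: c_def powr_realpow)
    also have "\<dots> \<le> K * b ^ n"
      using K assms(2) by simp
    finally show ?thesis .
  qed
  then show ?thesis
    using that[of K] K by (simp add: c_def)
qed

text \<open>
  On the annulus \<open>n - 1 < d \<le> n\<close> the weight is at most \<open>exp t * exp (- t * n)\<close> while the Haagerup
  content grows at most like \<open>exp (t * n / 2)\<close>, so the annuli contribute a geometric series.
\<close>

lemma heat_sum_bound:
  fixes d :: "'g::group_add \<Rightarrow> real"
  assumes \<sigma>: "cocycle \<sigma>" and d: "\<And>g. 0 \<le> d g" and proper: "proper_length d"
    and growth: "subexponential_H_growth d" and t: "0 < t"
  obtains C where "0 \<le> C"
    "\<And>a F. finite F \<Longrightarrow>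
       norm (\<Sum>g\<in>F. (heat_symbol d t g * a g) *\<^sub>C regular_rep \<sigma> g) \<le> C * L2_set (\<lambda>g. cmod (a g)) F"
proof -
  \<comment> \<open>The heat weight at distance \<open>n\<close> is then
    \<open>q ^ n * q ^ n\<close>: one factor cancels the growth \<open>(1 / q) ^ n\<close> of the
    content, the other gives a convergent geometric series.\<close>
  define q where "q = exp (- t / 2)"
  have q: "0 < q" "q < 1"
    using t by (simp_all add: q_def)
  obtain K where K: "0 \<le> K" "\<And>n::nat. haagerup_content {g. d g \<le> real n} \<le> K * (1 / q) ^ n"
    using subexponential_ball_bound[OF growth, of "1 / q"] q by auto
  \<comment> \<open>Rounding up puts \<open>g\<close> in the ball of radius \<open>\<nu> g\<close>;
    overshooting by at most 1 costs the factor \<open>exp t\<close> in the weight.\<close>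
  define \<nu> where "\<nu> g = nat \<lceil>d g\<rceil>" for g
  have \<nu>: "d g \<le> real (\<nu> g)" "real (\<nu> g) \<le> d g + 1" for g
    using d[of g] unfolding \<nu>_def by linarith+
  have fin: "finite {g. d g \<le> real n}" for n :: nat
    using proper by (simp add: proper_length_def)
  have annulus: "norm (\<Sum>g\<in>{g\<in>F. \<nu> g = n}. (heat_symbol d t g * a g) *\<^sub>C regular_rep \<sigma> g)
      \<le> K * exp t * L2_set (\<lambda>g. cmod (a g)) F * q ^ n" (is "norm ?S \<le> _")
    if F: "finite F" for F :: "'g set" and a n
  proof -
    let ?F = "{g\<in>F. \<nu> g = n}"
    have weight: "cmod (heat_symbol d t g * a g) \<le> exp t * q ^ n * q ^ n * cmod (a g)" if "\<nu> g = n" for g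
    proof -
      have "exp (- t * d g) \<le> exp (t + - t * real n)"
        using mult_left_mono[OF \<nu>(2)[of g], of t] that t by (simp add: algebra_simps)
      also have "\<dots> = exp t * q ^ n * q ^ n"
        by (simp add: q_def exp_add exp_of_nat_mult[symmetric] mult_exp_exp field_simps)
      finally show ?thesis
        by (simp add: heat_symbol_def norm_mult mult_right_mono)
    qed
    have "L2_set (\<lambda>g. cmod (heat_symbol d t g * a g)) ?F
        \<le> L2_set (\<lambda>g. exp t * q ^ n * q ^ n * cmod (a g)) ?F"
      by (rule L2_set_mono) (use weight in auto)
    also have "\<dots> = exp t * q ^ n * q ^ n * L2_set (\<lambda>g. cmod (a g)) ?F"
      using q by (simp add: L2_set_right_distrib)
    also have "\<dots> \<le> exp t * q ^ n * q ^ n * L2_set (\<lambda>g. cmod (a g)) F"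
      using q F by (intro mult_left_mono) (auto simp: L2_set_def intro!: sum_mono2)
    finally have l2: "L2_set (\<lambda>g. cmod (heat_symbol d t g * a g)) ?F
        \<le> exp t * q ^ n * q ^ n * L2_set (\<lambda>g. cmod (a g)) F" .
    have "norm ?S \<le> haagerup_content {g. d g \<le> real n} * L2_set (\<lambda>g. cmod (heat_symbol d t g * a g)) ?F"
      using \<nu>(1) by (intro norm_twisted_sum_le_haagerup_content[OF \<sigma> fin]) auto
    also have "\<dots> \<le> (K * (1 / q) ^ n) * (exp t * q ^ n * q ^ n * L2_set (\<lambda>g. cmod (a g)) F)"
      using K q l2 by (intro mult_mono) (auto simp: L2_set_nonneg)
    also have "\<dots> = K * exp t * L2_set (\<lambda>g. cmod (a g)) F * q ^ n"
      using q by (simp add: power_divide)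
    finally show ?thesis .
  qed
  define C where "C = K * exp t * (1 / (1 - q))"
  have "norm (\<Sum>g\<in>F. (heat_symbol d t g * a g) *\<^sub>C regular_rep \<sigma> g) \<le> C * L2_set (\<lambda>g. cmod (a g)) F"
    if F: "finite F" for F :: "'g set" and a
  proof -
    define l where "l = L2_set (\<lambda>g. cmod (a g)) F"
    have l: "0 \<le> l"
      by (simp add: l_def L2_set_nonneg)
    \<comment> \<open>Only the finitely many annuli meeting \<open>F\<close> occur, and their
      contributions are majorised by the full geometric series.\<close>
    have "norm (\<Sum>g\<in>F. (heat_symbol d t g * a g) *\<^sub>C regular_rep \<sigma> g)
        = norm (\<Sum>n\<in>\<nu> ` F. \<Sum>g\<in>{g\<in>F. \<nu> g = n}. (heat_symbol d t g * a g) *\<^sub>C regular_rep \<sigma> g)"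
      by (subst sum.image_gen[OF F, of _ \<nu>]) simp
    also have "\<dots> \<le> (\<Sum>n\<in>\<nu> ` F. K * exp t * l * q ^ n)"
      unfolding l_def by (rule sum_norm_le) (rule annulus[OF F])
    also have "\<dots> = K * exp t * l * (\<Sum>n\<in>\<nu> ` F. q ^ n)"
      by (simp add: sum_distrib_left)
    also have "\<dots> \<le> K * exp t * l * (1 / (1 - q))"
    proof (rule mult_left_mono)
      have "(\<Sum>n\<in>\<nu> ` F. q ^ n) \<le> (\<Sum>n. q ^ n)"
        by (rule sum_le_suminf) (use F q in auto)
      then show "(\<Sum>n\<in>\<nu> ` F. q ^ n) \<le> 1 / (1 - q)"
        using q by (simp add: suminf_geometric)
    qed (use K l in simp)
    finally show ?thesis
      by (simp add: C_def l_def mult_ac)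
  qed
  moreover have "0 \<le> C"
    using K q by (simp add: C_def)
  ultimately show ?thesis
    using that by blast
qed

lemma heat_symbol_MCF:
  fixes d :: "'g::group_add \<Rightarrow> real"
  assumes \<sigma>: "cocycle \<sigma>" and d: "\<And>g. 0 \<le> d g" and proper: "proper_length d"
    and growth: "subexponential_H_growth d" and t: "0 < t"
  shows "heat_symbol d t \<in> MCF \<sigma>"
proof -
  interpret op: vector_space op_scale by (rule vector_space_op_scale)
  define \<phi> where "\<phi> = heat_symbol d t"
  obtain C where C: "0 \<le> C" "\<And>a F. finite F \<Longrightarrow>
      norm (\<Sum>g\<in>F. (\<phi> g * a g) *\<^sub>C regular_rep \<sigma> g) \<le> C * L2_set (\<lambda>g. cmod (a g)) F"
    using heat_sum_bound[OF assms] unfolding \<phi>_def by metis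
  \<comment> \<open>Every bounded operator \<open>x\<close> is allowed here, since its Fourier
    coefficients are square-summable.\<close>
  define U where "U x g = (\<phi> g * ell2_fun (fourier x) g) *\<^sub>C regular_rep \<sigma> g" for x g
  define M where "M x = infsum (U x) UNIV" for x
  have dominated: "norm (sum (U x) F) \<le> C * sqrt (\<Sum>g\<in>F. (cmod (ell2_fun (fourier x) g))\<^sup>2)"
    if "finite F" for x F
    using C(2)[OF that, of "ell2_fun (fourier x)"] by (simp add: U_def L2_set_def)
  have U: "U x summable_on UNIV" for x
    by (rule summable_on_square_dominated(1)[OF ell2_summable _ C(1) dominated]) simp_all
  have norm_M: "norm (M x) \<le> C * norm (fourier x)" for x
    unfolding M_def norm_ell2.rep_eq
    by (rule summable_on_square_dominated(2)[OF ell2_summable _ C(1) dominated]) simp_all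
  \<comment> \<open>Coefficient functionals are continuous, so they may be applied termwise; only
    the term \<open>g = k\<close> survives.\<close>
  have fourier_M: "ell2_fun (fourier (M x)) k = \<phi> k * ell2_fun (fourier x) k" for x k
  proof -
    have "((\<lambda>g. ell2_fun (fourier (U x g)) k) has_sum ell2_fun (fourier (M x)) k) UNIV"
      unfolding M_def
      by (rule has_sum_bounded_linear[OF bounded_linear_fourier_coeff has_sum_infsum[OF U]])
    moreover have "((\<lambda>g. ell2_fun (fourier (U x g)) k) has_sum (\<phi> k * ell2_fun (fourier x) k)) UNIV"
      by (rule has_sum_finite_neutralI[of "{k}"])
        (auto simp: U_def fourier_op_scale fourier_regular_rep[OF \<sigma>])
    ultimately show ?thesis
      by (rule has_sum_unique)
  qed
  have M_mem: "M x \<in> reduced_algebra \<sigma>" for x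
    unfolding M_def reduced_algebra_def
    by (rule Lim_in_closed_set[OF closed_closure _ _ infsum_tendsto[OF U]])
      (auto simp: U_def intro!: subsetD[OF closure_subset sum_regular_rep_in_span])
  have mult: "is_multiplier_op \<sigma> \<phi> M"
    unfolding is_multiplier_op_def
  proof (intro conjI ballI allI)
    fix x y :: "'g ell2_op"
    have "U (x + y) = (\<lambda>g. U x g + U y g)"
      by (rule ext) (simp add: U_def fourier_def blinfun.add_left plus_ell2.rep_eq
          distrib_left op.scale_left_distrib)
    then show "M (x + y) = M x + M y"
      unfolding M_def by (simp add: infsum_add U)
  next
    fix c :: complex and x :: "'g ell2_op"
    have eq: "U (c *\<^sub>C x) = (\<lambda>g. c *\<^sub>C U x g)"
      by (rule ext) (simp add: U_def fourier_op_scale mult_ac)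
    have "((\<lambda>g. c *\<^sub>C U x g) has_sum c *\<^sub>C M x) UNIV"
      unfolding M_def
      by (rule has_sum_bounded_linear[OF bounded_linear_op_scale has_sum_infsum[OF U]])
    then show "M (c *\<^sub>C x) = c *\<^sub>C M x"
      unfolding M_def[of "c *\<^sub>C x"] eq by (rule infsumI)
  next
    have "norm (M x) \<le> C * norm x" for x
      using norm_M[of x] mult_left_mono[OF norm_fourier_le C(1), of x] by linarith
    then show "\<exists>K. \<forall>x\<in>reduced_algebra \<sigma>. norm (M x) \<le> K * norm x"
      by blast
  next
    fix g
    have "(U (regular_rep \<sigma> g) has_sum \<phi> g *\<^sub>C regular_rep \<sigma> g) UNIV"
      by (rule has_sum_finite_neutralI[of "{g}"]) (auto simp: U_def fourier_regular_rep[OF \<sigma>])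
    then show "M (regular_rep \<sigma> g) = \<phi> g *\<^sub>C regular_rep \<sigma> g"
      unfolding M_def by (rule infsumI)
  qed (rule M_mem)
  have "cmod (\<phi> g) \<le> 1" for g
    using d[of g] t by (simp add: \<phi>_def heat_symbol_def)
  then have "\<phi> \<in> MA \<sigma>"
    using mult unfolding MA_def by (auto intro: boundedI)
  \<comment> \<open>Uniqueness identifies the chosen operator with \<open>M\<close> on the reduced
    algebra. By \<open>fourier_M\<close>, the Fourier series of \<open>M x\<close> is termwise the
    summable family \<open>U x\<close>.\<close>
  moreover have "multiplier_op \<sigma> \<phi> x \<in> CF \<sigma>" if x: "x \<in> reduced_algebra \<sigma>" for x
  proof -
    have "is_multiplier_op \<sigma> \<phi> (multiplier_op \<sigma> \<phi>)"
      unfolding multiplier_op_def by (rule someI[of "is_multiplier_op \<sigma> \<phi>", OF mult])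
    then have "multiplier_op \<sigma> \<phi> x = M x"
      by (rule multiplier_op_unique[OF _ mult x])
    moreover have "(\<lambda>g. ell2_fun (fourier (M x)) g *\<^sub>C regular_rep \<sigma> g) summable_on UNIV"
      using U[of x] unfolding U_def[abs_def] fourier_M .
    ultimately show ?thesis
      by (simp add: CF_def M_mem)
  qed
  ultimately show ?thesis
    unfolding MCF_def \<phi>_def by blast
qed

theorem theorem3p45:
  fixes \<sigma> :: "'g::group_add \<Rightarrow> 'g \<Rightarrow> complex" and d :: "'g \<Rightarrow> real"
  assumes "countable (UNIV :: 'g set)" and "infinite (UNIV :: 'g set)"
    and "cocycle \<sigma>"
    and "d \<in> ND0_plus"
    and "proper_length d"
    and "subexponential_H_growth d"
  shows "heat_epsilon d \<sigma> = 0 \<and> heat_property \<sigma> d"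
proof -
  have "0 \<le> d g" for g
    using assms(4) by (simp add: ND0_plus_def)
  then have MCF: "heat_symbol d t \<in> MCF \<sigma>" if "0 < t" for t
    using heat_symbol_MCF[OF assms(3) _ assms(5,6) that] by blast
  \<comment> \<open>Every positive \<open>e\<close> belongs to the set whose infimum is
    taken.\<close>
  have "heat_epsilon d \<sigma> \<le> 0"
  proof (rule ennreal_le_epsilon)
    fix e :: real
    assume "0 < e"
    then show "heat_epsilon d \<sigma> \<le> 0 + ennreal e"
      unfolding heat_epsilon_def using MCF by (auto intro!: Inf_lower)
  qed
  then show ?thesis
    using MCF by (simp add: heat_property_def)
qed

end
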